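(* For every real $x$ with $|x|<1$, $$\int_0^\infty\left[\frac{\sinh(xt)}{t(e^t-1)}-\frac{x}{t e^t}\right]dt=\frac12\left[\log\Gamma(1-x)-\log\Gamma(1+x)\right].$$
   Context: $\Gamma$ is the gamma function. *)

theory Defs
  imports "HOL-Analysis.Analysis"
begin

end

theory Submission
  imports Defs "HOL-Real_Asymp.Real_Asymp"
begin

text \<open>
  Expanding \<open>1 / (exp t - 1)\<close> and \<open>exp (-t)\<close> as series in \<open>exp (-t)\<close> (the latter telescoping)
  writes the integrand as a sum over \<open>n \<ge> 1\<close> of Frullani integrands. For \<open>x \<ge> 0\<close> these are
  nonnegative, so monotone convergence applies, and the partial sums of the Frullani logarithms
  are those of Euler's limit formula for \<open>ln (Gamma (1 - x)) - ln (Gamma (1 + x))\<close>. Both sides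
  are odd in \<open>x\<close>.
\<close>

text \<open>The integrand equals the integral of \<open>exp (- (s * t))\<close> over
  \<open>s\<close> in \<open>{a..b}\<close>. By Tonelli the order can be swapped, and integrating
  over \<open>t\<close> first leaves \<open>1 / s\<close>. The ordering \<open>a \<le> b\<close>
  keeps everything nonnegative, so integrability comes along with the value.\<close>

lemma frullani_exp_nonneg:
  fixes a b :: real
  assumes "0 < a" "a \<le> b"
  shows "((\<lambda>t. (exp (- a * t) - exp (- b * t)) / t) has_integral (ln b - ln a)) {0<..}"
proof -
  define f where "f t = indicator {0<..} t * ((exp (- a * t) - exp (- b * t)) / t)" for t :: real
  have measurable: "f \<in> borel_measurable borel"
    unfolding f_def by measurable
  have nonneg: "f t \<ge> 0" for t
    using assms by (auto simp: f_def indicator_def intro!: divide_nonneg_pos mult_right_mono)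
  have inner_s: "(\<integral>\<^sup>+s. ennreal (exp (- (s * t))) * indicator {a..b} s \<partial>lborel)
      = ennreal ((exp (- (a * t)) - exp (- (b * t))) / t)" if "t > 0" for t
  proof -
    have "(\<integral>\<^sup>+s. ennreal (exp (- (s * t))) * indicator {a..b} s \<partial>lborel)
        = ennreal ((- exp (- (b * t)) / t) - (- exp (- (a * t)) / t))"
      using that assms
      by (intro nn_integral_FTC_Icc) (auto intro!: derivative_eq_intros simp: field_simps)
    thus ?thesis by (simp add: diff_divide_distrib)
  qed
  have inner_t: "(\<integral>\<^sup>+t. ennreal (exp (- (s * t))) * indicator {0..} t \<partial>lborel) = ennreal (1 / s)"
    if "s > 0" for s
  proof -
    have "((\<lambda>t. - exp (- (s * t)) / s) \<longlongrightarrow> 0) at_top"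
      using that by real_asymp
    hence "(\<integral>\<^sup>+t. ennreal (exp (- (s * t))) * indicator {0..} t \<partial>lborel)
        = ennreal (0 - (- exp (- (s * 0)) / s))"
      using that
      by (intro nn_integral_FTC_atLeast) (auto intro!: derivative_eq_intros simp: field_simps)
    thus ?thesis by simp
  qed
  have "(\<integral>\<^sup>+t. ennreal (f t) \<partial>lborel)
      = (\<integral>\<^sup>+t. (\<integral>\<^sup>+s. ennreal (exp (- (s * t))) * indicator {a..b} s * indicator {0<..} t \<partial>lborel) \<partial>lborel)"
    by (intro nn_integral_cong) (auto simp: f_def indicator_eq_0_iff nn_integral_multc inner_s split: split_indicator)
  also have "\<dots> = (\<integral>\<^sup>+s. (\<integral>\<^sup>+t. ennreal (exp (- (s * t))) * indicator {a..b} s * indicator {0<..} t \<partial>lborel) \<partial>lborel)"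
    by (rule lborel_pair.Fubini') measurable
  \<comment> \<open>Adding the null set \<open>{0}\<close> gives the closed half-line on which
    \<open>inner_t\<close> is stated.\<close>
  also have "\<dots> = (\<integral>\<^sup>+s. (\<integral>\<^sup>+t. ennreal (exp (- (s * t))) * indicator {0..} t * indicator {a..b} s \<partial>lborel) \<partial>lborel)"
    by (intro nn_integral_cong nn_integral_cong_AE eventually_mono[OF AE_lborel_singleton[of 0]])
       (auto simp: indicator_def)
  also have "\<dots> = (\<integral>\<^sup>+s. ennreal (1 / s) * indicator {a..b} s \<partial>lborel)"
    using assms by (intro nn_integral_cong) (auto simp: inner_t nn_integral_multc split: split_indicator)
  also have "\<dots> = ennreal (ln b - ln a)"
    using assms by (intro nn_integral_FTC_Icc) (auto intro!: derivative_eq_intros)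
  finally have "(f has_integral (ln b - ln a)) UNIV"
    using assms nonneg measurable by (intro nn_integral_has_integral) auto
  moreover have "f = (\<lambda>t. if t \<in> {0<..} then (exp (- a * t) - exp (- b * t)) / t else 0)"
    by (auto simp: f_def)
  ultimately show ?thesis
    by (simp only: has_integral_restrict_UNIV)
qed

text \<open>The summands are the integrals of the series terms. Their logarithmic quotients come
  from Euler's formula at \<open>1 - x\<close> and \<open>1 + x\<close>; the \<open>x\<close>-terms
  telescope and stand in for its \<open>x * ln N\<close>.\<close>

lemma ln_Gamma_diff_LIMSEQ:
  fixes x :: real
  assumes "\<bar>x\<bar> < 1"
  shows "(\<lambda>N. \<Sum>k<N. (ln (real k + 1 + x) - ln (real k + 1 - x)) / 2 - x * (ln (real k + 2) - ln (real k + 1)))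
           \<longlonglongrightarrow> (ln (Gamma (1 - x)) - ln (Gamma (1 + x))) / 2"
    (is "?S \<longlonglongrightarrow> ?L")
proof -
  \<comment> \<open>The isolated terms \<open>- ln z\<close> of the two series provide the summand
    \<open>k = 0\<close>, hence \<open>Suc N\<close> terms in all.\<close>
  have series: "ln_Gamma_series (1 - x) N - ln_Gamma_series (1 + x) N
      = - (2 * x) * ln (real N) + (\<Sum>k<Suc N. ln (real k + 1 + x) - ln (real k + 1 - x))" for N
  proof -
    have "(\<Sum>k=1..N. ln ((1 + x) / real k + 1)) - (\<Sum>k=1..N. ln ((1 - x) / real k + 1))
        = (\<Sum>k=1..N. ln (real k + 1 + x) - ln (real k + 1 - x))"
      unfolding sum_subtractf [symmetric]
    proof (intro sum.cong refl)
      fix k assume "k \<in> {1..N}"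
      hence k: "real k > 0" by auto
      have "(1 + x) / real k + 1 = (real k + 1 + x) / real k"
           "(1 - x) / real k + 1 = (real k + 1 - x) / real k"
        using k by (auto simp: field_simps)
      moreover have pos: "real k + 1 + x > 0" "real k + 1 - x > 0"
        using assms by linarith+
      ultimately show "ln ((1 + x) / real k + 1) - ln ((1 - x) / real k + 1)
          = ln (real k + 1 + x) - ln (real k + 1 - x)"
        using k pos by (simp add: ln_div)
    qed
    moreover have "(\<Sum>k<Suc N. ln (real k + 1 + x) - ln (real k + 1 - x))
        = ln (1 + x) - ln (1 - x) + (\<Sum>k=1..N. ln (real k + 1 + x) - ln (real k + 1 - x))"
      by (simp add: lessThan_Suc_atMost sum.atMost_shift sum.atLeast1_atMost_eq)
    ultimately show ?thesis
      by (simp add: ln_Gamma_series_def algebra_simps)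
  qed
  have telescope: "(\<Sum>k<N. ln (real k + 2) - ln (real k + 1)) = ln (real N + 1)" for N
    by (induction N) (auto simp: algebra_simps)
  \<comment> \<open>Telescoping yields \<open>ln (N + 2)\<close> where Euler's formula has
    \<open>ln N\<close>; this discrepancy tends to 0.\<close>
  have "?S (Suc N) = (ln_Gamma_series (1 - x) N - ln_Gamma_series (1 + x) N) / 2
                       - x * (ln (real N + 2) - ln (real N))" for N
  proof -
    have "?S (Suc N) = (\<Sum>k<Suc N. ln (real k + 1 + x) - ln (real k + 1 - x)) / 2
                       - x * (\<Sum>k<Suc N. ln (real k + 2) - ln (real k + 1))"
      by (simp only: sum_subtractf[of "\<lambda>k. _ k / 2"] sum_divide_distrib sum_distrib_left)
    also have "\<dots> = (ln_Gamma_series (1 - x) N - ln_Gamma_series (1 + x) N) / 2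
                       - x * (ln (real N + 2) - ln (real N))"
      unfolding series telescope by (simp add: field_simps del: sum.lessThan_Suc)
    finally show ?thesis .
  qed
  moreover have "(\<lambda>N. (ln_Gamma_series (1 - x) N - ln_Gamma_series (1 + x) N) / 2
                   - x * (ln (real N + 2) - ln (real N)))
      \<longlonglongrightarrow> (ln_Gamma (1 - x) - ln_Gamma (1 + x)) / 2 - x * 0"
  proof (intro tendsto_intros ln_Gamma_real_LIMSEQ)
    show "(\<lambda>N. ln (real N + 2) - ln (real N)) \<longlonglongrightarrow> 0" by real_asymp
  qed (use assms in auto)
  ultimately have "(\<lambda>N. ?S (Suc N)) \<longlonglongrightarrow> ?L"
    using assms by (simp add: ln_Gamma_real_pos)
  thus ?thesis by (rule LIMSEQ_imp_Suc)
qed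

lemma sinh_ge_self:
  fixes y :: real
  assumes "y \<ge> 0"
  shows "sinh y \<ge> y"
proof -
  have "sinh 0 - 0 \<le> sinh y - y"
    using assms
    by (rule DERIV_nonneg_imp_nondecreasing[of 0 y "\<lambda>y. sinh y - y"])
       (auto intro!: exI derivative_eq_intros cosh_real_ge_1)
  thus ?thesis by simp
qed

lemma sinh_integral_nonneg:
  fixes x :: real
  assumes "0 \<le> x" "x < 1"
  shows "((\<lambda>t. sinh (x * t) / (t * (exp t - 1)) - x / (t * exp t))
            has_integral (ln (Gamma (1 - x)) - ln (Gamma (1 + x))) / 2) {0<..}"
proof -
  \<comment> \<open>The \<open>sinh\<close> part is a term of the geometric series for
    \<open>1 / (exp t - 1)\<close>, the rest a telescoping term of \<open>x * exp (- t)\<close>. The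
    integral of the \<open>sinh\<close> part alone is asymptotic to \<open>x / k\<close>, so for
    \<open>x \<noteq> 0\<close> those integrals have a divergent sum; the telescoping part
    compensates for this.\<close>
  define h where "h k t = exp (- (real k + 1) * t) * (sinh (x * t) - x * (1 - exp (- t))) / t"
    for k :: nat and t :: real
  have h_integral: "(h k has_integral ((ln (real k + 1 + x) - ln (real k + 1 - x)) / 2
                       - x * (ln (real k + 2) - ln (real k + 1)))) {0<..}" for k
  proof -
    \<comment> \<open>Splitting \<open>sinh\<close> into exponentials gives two Frullani integrals.
      The bound \<open>x < 1\<close> makes \<open>k + 1 - x\<close> positive even for
      \<open>k = 0\<close>, and \<open>0 \<le> x\<close> orders the endpoints.\<close>
    have "((\<lambda>t. (exp (- (real k + 1 - x) * t) - exp (- (real k + 1 + x) * t)) / t * (1 / 2)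
             - x * ((exp (- (real k + 1) * t) - exp (- (real k + 2) * t)) / t)) has_integral
           ((ln (real k + 1 + x) - ln (real k + 1 - x)) * (1 / 2)
             - x * (ln (real k + 2) - ln (real k + 1)))) {0<..}"
      using assms
      by (intro has_integral_diff has_integral_mult_left has_integral_mult_right frullani_exp_nonneg) auto
    moreover have "(exp (- (real k + 1 - x) * t) - exp (- (real k + 1 + x) * t)) / t * (1 / 2)
             - x * ((exp (- (real k + 1) * t) - exp (- (real k + 2) * t)) / t) = h k t" for t
    proof -
      have "exp (- (real k + 1 - x) * t) = exp (- (real k + 1) * t) * exp (x * t)"
           "exp (- (real k + 1 + x) * t) = exp (- (real k + 1) * t) * exp (- (x * t))"
           "exp (- (real k + 2) * t) = exp (- (real k + 1) * t) * exp (- t)"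
        by (simp_all add: exp_add[symmetric] algebra_simps)
      thus ?thesis
        by (simp add: h_def sinh_field_def diff_divide_distrib add_divide_distrib algebra_simps)
    qed
    ultimately show ?thesis by simp
  qed
  have h_nonneg: "h k t \<ge> 0" if "t > 0" for k t
  proof -
    \<comment> \<open>The value \<open>x * t\<close> separates the two terms of the numerator, since
      \<open>1 - exp (- t) \<le> t\<close> and \<open>y \<le> sinh y\<close> for
      \<open>y \<ge> 0\<close>.\<close>
    have "x * (1 - exp (- t)) \<le> x * t"
      using assms exp_ge_add_one_self[of "- t"] by (intro mult_left_mono) auto
    also have "\<dots> \<le> sinh (x * t)"
      using assms that by (intro sinh_ge_self) auto
    finally show ?thesis
      using that by (auto simp: h_def)
  qed
  have h_sums: "(\<lambda>N. \<Sum>k<N. h k t) \<longlonglongrightarrow> sinh (x * t) / (t * (exp t - 1)) - x / (t * exp t)"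
    if "t > 0" for t
  proof -
    have "(\<lambda>k. exp (- t) ^ k) sums (1 / (1 - exp (- t)))"
      using that by (intro geometric_sums) auto
    hence "(\<lambda>k. exp (- t) ^ k * (exp (- t) * (sinh (x * t) - x * (1 - exp (- t))) / t)) sums
        (1 / (1 - exp (- t)) * (exp (- t) * (sinh (x * t) - x * (1 - exp (- t))) / t))"
      by (rule sums_mult2)
    moreover have "exp (- t) ^ k * (exp (- t) * (sinh (x * t) - x * (1 - exp (- t))) / t) = h k t" for k
    proof -
      have "exp (- (real k + 1) * t) = exp (- t) ^ k * exp (- t)"
        by (simp add: exp_of_nat_mult[symmetric] exp_add[symmetric] algebra_simps)
      thus ?thesis by (simp add: h_def)
    qed
    moreover have "1 / (1 - exp (- t)) * (exp (- t) * (sinh (x * t) - x * (1 - exp (- t))) / t)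
        = sinh (x * t) / (t * (exp t - 1)) - x / (t * exp t)"
    proof -
      \<comment> \<open>In terms of \<open>E\<close> the claim is a rational identity with
        \<open>sinh (x * t)\<close> as an atom.\<close>
      define E where "E = exp t"
      have "E > 1" "exp (- t) = 1 / E"
        using that by (auto simp: E_def exp_minus inverse_eq_divide)
      thus ?thesis
        using that unfolding \<open>exp (- t) = 1 / E\<close> E_def[symmetric]
        by (simp add: divide_simps)
    qed
    ultimately show ?thesis by (simp add: sums_def)
  qed
  show ?thesis
  proof (rule has_integral_monotone_convergence_increasing[where f = "\<lambda>N t. \<Sum>k<N. h k t"])
    show "((\<lambda>t. \<Sum>k<N. h k t) has_integral (\<Sum>k<N. (ln (real k + 1 + x) - ln (real k + 1 - x)) / 2
                       - x * (ln (real k + 2) - ln (real k + 1)))) {0<..}" for N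
      by (intro has_integral_sum h_integral) auto
  qed (use assms in \<open>auto intro!: h_sums ln_Gamma_diff_LIMSEQ simp: h_nonneg\<close>)
qed

theorem mainTheorem3:
  fixes x :: real
  assumes "\<bar>x\<bar> < 1"
  shows "((\<lambda>t::real. sinh (x * t) / (t * (exp t - 1)) - x / (t * exp t))
            has_integral (1 / 2 * (ln (Gamma (1 - x)) - ln (Gamma (1 + x))))) {0<..}"
proof (cases "x \<ge> 0")
  case True
  thus ?thesis using sinh_integral_nonneg[of x] assms by simp
next
  case False
  \<comment> \<open>Both sides are odd in \<open>x\<close>, so the nonnegative case is applied to
    \<open>- x\<close> and negated.\<close>
  hence "((\<lambda>t. - (sinh (- x * t) / (t * (exp t - 1)) - (- x) / (t * exp t)))
            has_integral - ((ln (Gamma (1 - (- x))) - ln (Gamma (1 + (- x)))) / 2)) {0<..}"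
    using assms by (intro has_integral_neg sinh_integral_nonneg) auto
  thus ?thesis by (simp add: algebra_simps diff_divide_distrib)
qed

end
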